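(* For every integer $n\ge 3$, there is no pretty good state transfer (between any two distinct vertices) in the corona $K_n\circ\overline{K}_2$.
   Context: $K_n$ is the complete graph on $n$ vertices and $\overline{K}_2$ is the edgeless graph on $2$ vertices. The corona $G\circ H$ of graphs $G,H$ has vertex set $V(G)\times(\{0\}\cup V(H))$ (where $0\notin V(H)$), and $(v,w)$ is adjacent to $(v',w')$ iff one of the following holds: $w=w'=0$ and $v,v'$ are adjacent in $G$; or $v=v'$ and $w,w'\in V(H)$ are adjacent in $H$; or $v=v'$ and exactly one of $w,w'$ equals $0$. A graph $X$ with adjacency matrix $A(X)$ has pretty good state transfer between vertices $a,b$ if for every $\epsilon>0$ there are a time $\tau$ and a complex number $\gamma$ with $|\gamma|=1$ such that $\|e^{-\mathrm{i}\tau A(X)}e_a-\gamma e_b\|<\epsilon$, where $e_a$ is the standard basis vector indexed by $a$. *)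

theory Defs
  imports "HOL-Analysis.Analysis"
begin

text \<open>A graph on a finite type \<open>'v\<close> of vertices is given by its adjacency relation.\<close>

type_synonym 'v graph = "'v \<Rightarrow> 'v \<Rightarrow> bool"

definition simple_graph :: "'v graph \<Rightarrow> bool" where
  "simple_graph G \<longleftrightarrow> symp G \<and> irreflp G"

definition complete_graph :: "'v graph" where
  "complete_graph u v \<longleftrightarrow> u \<noteq> v"

definition edgeless_graph :: "'v graph" where
  "edgeless_graph u v \<longleftrightarrow> False"

text \<open>The vertex set \<open>V(G) \<times> ({0} \<union> V(H))\<close> is rendered as \<open>'v \<times> 'w option\<close>:
  \<^const>\<open>None\<close> is the extra symbol 0, and \<open>Some x\<close> is the vertex \<open>x\<close> of \<open>H\<close>.\<close>

definition corona :: "'v graph \<Rightarrow> 'w graph \<Rightarrow> ('v \<times> 'w option) graph" where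
  "corona G H = (\<lambda>(v, w) (v', w').
     (w = None \<and> w' = None \<and> G v v') \<or>
     (v = v' \<and> (\<exists>x y. w = Some x \<and> w' = Some y \<and> H x y)) \<or>
     (v = v' \<and> (w = None) \<noteq> (w' = None)))"

lemma simple_graph_complete_graph: "simple_graph complete_graph"
  by (auto simp: simple_graph_def complete_graph_def intro!: sympI irreflpI)

lemma simple_graph_edgeless_graph: "simple_graph edgeless_graph"
  by (auto simp: simple_graph_def edgeless_graph_def intro!: sympI irreflpI)

lemma simple_graph_corona:
  assumes "simple_graph G" "simple_graph H"
  shows "simple_graph (corona G H)"
  using assms unfolding simple_graph_def corona_def symp_def irreflp_def
  by (auto split: prod.splits)

definition adjacency_matrix :: "'v::finite graph \<Rightarrow> complex^'v^'v" where
  "adjacency_matrix G = (\<chi> u v. of_bool (G u v))"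

primrec mat_power :: "complex^'v^'v \<Rightarrow> nat \<Rightarrow> complex^'v^'v::finite" where
  "mat_power M 0 = mat 1"
| "mat_power M (Suc k) = M ** mat_power M k"

text \<open>The type \<open>complex^'v^'v\<close> is not an instance of the class of Banach algebras on which
  \<^const>\<open>exp\<close> is defined, so the exponential series is repeated here with the matrix product.\<close>

definition mat_exp :: "complex^'v^'v \<Rightarrow> complex^'v^'v::finite" where
  "mat_exp M = (\<Sum>k. mat_power M k /\<^sub>R fact k)"

lemma norm_mat_power_entry_le:
  fixes M :: "complex^'v^'v::finite"
  shows "norm (mat_power M k $ i $ j) \<le> (real CARD('v) * norm M) ^ k"
proof (induction k arbitrary: i j)
  case 0
  then show ?case by (simp add: mat_def)
next
  case (Suc k)
  let ?B = "(real CARD('v) * norm M) ^ k"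
  have entry: "norm (M $ i $ l) \<le> norm M" for l
    using Finite_Cartesian_Product.norm_nth_le[of "M $ i" l]
      Finite_Cartesian_Product.norm_nth_le[of M i] by linarith
  have "norm (mat_power M (Suc k) $ i $ j) \<le> (\<Sum>l\<in>UNIV. norm (M $ i $ l * mat_power M k $ l $ j))"
    by (simp add: matrix_matrix_mult_def norm_sum)
  also have "\<dots> \<le> (\<Sum>l\<in>(UNIV::'v set). norm M * ?B)"
    unfolding norm_mult by (intro sum_mono mult_mono entry Suc.IH) auto
  also have "\<dots> = (real CARD('v) * norm M) ^ Suc k" by simp
  finally show ?case .
qed

lemma summable_mat_exp:
  fixes M :: "complex^'v^'v::finite"
  shows "summable (\<lambda>k. mat_power M k /\<^sub>R fact k)"
proof (rule summable_comparison_test)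
  let ?c = "real CARD('v) * norm M"
  show "summable (\<lambda>k. real CARD('v) * (real CARD('v) * (?c ^ k /\<^sub>R fact k)))"
    by (intro summable_mult summable_exp_generic)
  have "norm (mat_power M k /\<^sub>R fact k) \<le> real CARD('v) * (real CARD('v) * (?c ^ k /\<^sub>R fact k))" for k
  proof -
    have "norm (mat_power M k) \<le> (\<Sum>i\<in>UNIV. norm (mat_power M k $ i))"
      by (simp add: norm_vec_def L2_set_le_sum)
    also have "\<dots> \<le> (\<Sum>i\<in>UNIV. \<Sum>j\<in>UNIV. norm (mat_power M k $ i $ j))"
      by (intro sum_mono) (simp add: norm_vec_def L2_set_le_sum)
    also have "\<dots> \<le> (\<Sum>i\<in>(UNIV::'v set). \<Sum>j\<in>(UNIV::'v set). ?c ^ k)"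
      by (intro sum_mono norm_mat_power_entry_le)
    finally have "norm (mat_power M k) \<le> real CARD('v) * (real CARD('v) * ?c ^ k)" by simp
    then have "norm (mat_power M k) / fact k \<le> real CARD('v) * (real CARD('v) * ?c ^ k) / fact k"
      by (rule divide_right_mono) simp
    then show ?thesis by (simp add: field_simps)
  qed
  then show "\<exists>N. \<forall>k\<ge>N. norm (mat_power M k /\<^sub>R fact k)
      \<le> real CARD('v) * (real CARD('v) * (?c ^ k /\<^sub>R fact k))" by blast
qed

definition transition_matrix :: "'v::finite graph \<Rightarrow> real \<Rightarrow> complex^'v^'v" where
  "transition_matrix G \<tau> = mat_exp (\<chi> u v. - \<i> * of_real \<tau> * adjacency_matrix G $ u $ v)"

definition pretty_good_state_transfer :: "'v::finite graph \<Rightarrow> 'v \<Rightarrow> 'v \<Rightarrow> bool" where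
  "pretty_good_state_transfer G a b \<longleftrightarrow>
     (\<forall>\<epsilon>>0. \<exists>(\<tau>::real) (\<gamma>::complex). norm \<gamma> = 1 \<and>
        norm (transition_matrix G \<tau> *v axis a 1 - \<gamma> *s axis b 1) < \<epsilon>)"

end

theory Submission
  imports Defs
begin

text \<open>Pairing the transition matrix with an eigenvector \<open>x\<close> of the graph for the eigenvalue \<open>\<theta>\<close>
  replaces the matrix by the phase \<open>exp (- \<i> \<tau> \<theta>)\<close>. Pretty good state transfer from \<open>a\<close> to \<open>b\<close>
  therefore gives, for every \<open>\<delta> > 0\<close>, one time \<open>\<tau>\<close> and one phase \<open>\<gamma>\<close> such that
  \<open>exp (- \<i> \<tau> \<theta>) x(a)\<close> is within \<open>\<delta> \<parallel>x\<parallel>\<^sub>1\<close> of \<open>\<gamma> x(b)\<close> for all eigenvectors simultaneously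
  (\<open>pgst_eigenfunction_approx\<close>). In particular \<open>\<bar>x(a)\<bar> = \<bar>x(b)\<bar>\<close> for every eigenvector
  (\<open>pgst_eigenfunction_norm_eq\<close>).

  Three kinds of eigenvectors of the corona of \<open>K\<^sub>n\<close> with two isolated vertices suffice.
  The difference of the two leaves at a vertex \<open>v\<close> has eigenvalue \<open>0\<close>. A function \<open>c\<close> on \<open>K\<^sub>n\<close> with
  sum zero extends to eigenvectors for the roots \<open>1\<close> and \<open>-2\<close> of \<open>\<theta>\<^sup>2 + \<theta> = 2\<close>.
  Equality of moduli on the leaf differences shows that if \<open>a\<close> or \<open>b\<close> is a leaf, then \<open>a\<close> and \<open>b\<close> are
  the two leaves at one vertex. If neither is a leaf, then a function \<open>c\<close> that is supported on \<open>a\<close> and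
  a third vertex of \<open>K\<^sub>n\<close> violates equality of moduli; this is where \<open>n \<ge> 3\<close> enters.
  In the remaining case of two leaves at one vertex, the eigenvalue \<open>0\<close> forces \<open>\<gamma> \<approx> -1\<close>, hence the
  eigenvalue \<open>1\<close> forces \<open>exp (- \<i> \<tau>) \<approx> -1\<close>, while the eigenvalue \<open>-2\<close> forces
  \<open>exp (- \<i> \<tau>) ^ 2 \<approx> -1\<close>, which is impossible.\<close>

section \<open>Eigenvectors and the transition matrix\<close>

text \<open>The function \<open>x\<close> on the vertices satisfies \<open>A(G) x = \<theta> x\<close>. The zero function is admitted.\<close>

definition graph_eigenfunction :: "'v::finite graph \<Rightarrow> real \<Rightarrow> ('v \<Rightarrow> complex) \<Rightarrow> bool" where
  "graph_eigenfunction G \<theta> x \<longleftrightarrow> (\<forall>u. (\<Sum>v | G u v. x v) = of_real \<theta> * x u)"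

lemma mat_power_left_eigenvector:
  fixes M :: "complex^'v^'v::finite"
  assumes "\<And>v. (\<Sum>u\<in>UNIV. x u * M $ u $ v) = \<mu> * x v"
  shows "(\<Sum>u\<in>UNIV. x u * mat_power M k $ u $ v) = \<mu> ^ k * x v"
proof (induction k arbitrary: v)
  case 0
  then show ?case by (simp add: mat_def if_distrib cong: if_cong)
next
  case (Suc k)
  have "(\<Sum>u\<in>UNIV. x u * mat_power M (Suc k) $ u $ v)
      = (\<Sum>u\<in>UNIV. \<Sum>l\<in>UNIV. x u * M $ u $ l * mat_power M k $ l $ v)"
    by (simp add: matrix_matrix_mult_def sum_distrib_left mult.assoc)
  also have "\<dots> = (\<Sum>l\<in>UNIV. (\<Sum>u\<in>UNIV. x u * M $ u $ l) * mat_power M k $ l $ v)"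
    by (subst sum.swap) (simp add: sum_distrib_right)
  also have "\<dots> = \<mu> * (\<Sum>l\<in>UNIV. x l * mat_power M k $ l $ v)"
    by (simp add: assms sum_distrib_left mult.assoc)
  finally show ?case by (simp add: Suc.IH)
qed

lemma mat_exp_left_eigenvector:
  fixes M :: "complex^'v^'v::finite"
  assumes "\<And>v. (\<Sum>u\<in>UNIV. x u * M $ u $ v) = \<mu> * x v"
  shows "(\<Sum>u\<in>UNIV. x u * mat_exp M $ u $ v) = exp \<mu> * x v"
proof -
  have entry: "bounded_linear (\<lambda>X::complex^'v^'v. X $ u $ v)" for u
    by (intro bounded_linear_compose[OF bounded_linear_vec_nth bounded_linear_vec_nth])
  have "bounded_linear (\<lambda>X::complex^'v^'v. \<Sum>u\<in>UNIV. x u * X $ u $ v)"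
    by (intro bounded_linear_sum bounded_linear_const_mult entry)
  then have "(\<lambda>k. \<Sum>u\<in>UNIV. x u * (mat_power M k /\<^sub>R fact k) $ u $ v)
      sums (\<Sum>u\<in>UNIV. x u * mat_exp M $ u $ v)"
    unfolding mat_exp_def
    by (rule bounded_linear.sums) (rule summable_sums[OF summable_mat_exp])
  moreover have "(\<Sum>u\<in>UNIV. x u * (mat_power M k /\<^sub>R fact k) $ u $ v)
      = (\<mu> ^ k /\<^sub>R fact k) * x v" for k
    using mat_power_left_eigenvector[of x M \<mu> k v] assms
    by (simp add: scaleR_sum_right[symmetric])
  ultimately have "(\<lambda>k. (\<mu> ^ k /\<^sub>R fact k) * x v) sums (\<Sum>u\<in>UNIV. x u * mat_exp M $ u $ v)"
    by simp
  moreover have "(\<lambda>k. (\<mu> ^ k /\<^sub>R fact k) * x v) sums (exp \<mu> * x v)"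
    by (intro sums_mult2 exp_converges)
  ultimately show ?thesis by (rule sums_unique2)
qed

lemma transition_matrix_eigenfunction:
  fixes G :: "'v::finite graph"
  assumes "simple_graph G" and x: "graph_eigenfunction G \<theta> x"
  shows "(\<Sum>u\<in>UNIV. x u * transition_matrix G \<tau> $ u $ v) = cis (- (\<tau> * \<theta>)) * x v"
proof -
  have sym: "G u v = G v u" for u v
    using assms(1) by (auto simp: simple_graph_def dest: sympD)
  have "(\<Sum>u\<in>UNIV. x u * (\<chi> u v. - \<i> * of_real \<tau> * adjacency_matrix G $ u $ v) $ u $ v)
      = - \<i> * of_real \<tau> * of_real \<theta> * x v" for v
  proof -
    have "(\<Sum>u\<in>UNIV. x u * (\<chi> u v. - \<i> * of_real \<tau> * adjacency_matrix G $ u $ v) $ u $ v)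
        = - \<i> * of_real \<tau> * (\<Sum>u\<in>UNIV. x u * of_bool (G v u))"
      unfolding sum_distrib_left
      by (intro sum.cong refl) (simp add: adjacency_matrix_def sym[of _ v])
    also have "(\<Sum>u\<in>UNIV. x u * of_bool (G v u)) = (\<Sum>u | G v u. x u)"
      by (rule sum.mono_neutral_cong_right) auto
    also have "\<dots> = of_real \<theta> * x v" using x by (simp add: graph_eigenfunction_def)
    finally show ?thesis by (simp only: mult.assoc)
  qed
  then have "(\<Sum>u\<in>UNIV. x u * transition_matrix G \<tau> $ u $ v)
      = exp (- \<i> * of_real \<tau> * of_real \<theta>) * x v"
    unfolding transition_matrix_def by (intro mat_exp_left_eigenvector)
  then show ?thesis by (simp add: cis_conv_exp mult.assoc)
qed

section \<open>Consequences of pretty good state transfer\<close>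

lemma pgst_eigenfunction_approx:
  fixes G :: "'v::finite graph"
  assumes "simple_graph G" and "pretty_good_state_transfer G a b" and "\<delta> > 0"
  obtains \<tau> :: real and \<gamma> :: complex where "norm \<gamma> = 1"
    and "\<And>\<theta> x. graph_eigenfunction G \<theta> x \<Longrightarrow>
      norm (cis (- (\<tau> * \<theta>)) * x a - \<gamma> * x b) \<le> \<delta> * (\<Sum>u\<in>UNIV. norm (x u))"
proof -
  obtain \<tau> :: real and \<gamma> :: complex where \<gamma>: "norm \<gamma> = 1"
    and close: "norm (transition_matrix G \<tau> *v axis a 1 - \<gamma> *s axis b 1) < \<delta>"
    using assms(2,3) unfolding pretty_good_state_transfer_def by blast
  have "norm (cis (- (\<tau> * \<theta>)) * x a - \<gamma> * x b) \<le> \<delta> * (\<Sum>u\<in>UNIV. norm (x u))"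
    if x: "graph_eigenfunction G \<theta> x" for \<theta> x
  proof -
    let ?d = "transition_matrix G \<tau> *v axis a 1 - \<gamma> *s axis b 1"
    have "(\<Sum>u\<in>UNIV. x u * ?d $ u)
        = (\<Sum>u\<in>UNIV. x u * transition_matrix G \<tau> $ u $ a) - (\<Sum>u\<in>UNIV. if u = b then \<gamma> * x u else 0)"
      unfolding sum_subtractf[symmetric]
      by (intro sum.cong) (auto simp: matrix_vector_mul_component inner_axis axis_def matrix_vector_mult_def
          if_distrib algebra_simps cong: if_cong)
    also have "\<dots> = cis (- (\<tau> * \<theta>)) * x a - \<gamma> * x b"
      using transition_matrix_eigenfunction[OF assms(1) x] by simp
    finally have "norm (cis (- (\<tau> * \<theta>)) * x a - \<gamma> * x b) = norm (\<Sum>u\<in>UNIV. x u * ?d $ u)"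
      by simp
    also have "\<dots> \<le> (\<Sum>u\<in>UNIV. norm (x u) * norm (?d $ u))"
      by (rule order_trans[OF norm_sum]) (simp add: norm_mult)
    also have "\<dots> \<le> (\<Sum>u\<in>UNIV. norm (x u) * \<delta>)"
      using close Finite_Cartesian_Product.norm_nth_le[of ?d]
      by (intro sum_mono mult_left_mono) (auto intro: order_trans less_imp_le)
    also have "\<dots> = \<delta> * (\<Sum>u\<in>UNIV. norm (x u))"
      by (simp add: sum_distrib_left mult.commute)
    finally show ?thesis .
  qed
  with \<gamma> show ?thesis by (rule that)
qed

lemma pgst_eigenfunction_norm_eq:
  fixes G :: "'v::finite graph"
  assumes "simple_graph G" and "pretty_good_state_transfer G a b"
    and "graph_eigenfunction G \<theta> x"
  shows "norm (x a) = norm (x b)"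
proof (rule ccontr)
  assume "norm (x a) \<noteq> norm (x b)"
  then have gap: "\<bar>norm (x a) - norm (x b)\<bar> > 0" by simp
  define S where "S = (\<Sum>u\<in>UNIV. norm (x u))"
  have "S \<ge> 0" by (simp add: S_def sum_nonneg)
  define \<delta> where "\<delta> = \<bar>norm (x a) - norm (x b)\<bar> / (S + 1)"
  have "\<delta> > 0" using gap \<open>S \<ge> 0\<close> by (simp add: \<delta>_def)
  obtain \<tau> \<gamma> where "norm \<gamma> = 1" and "norm (cis (- (\<tau> * \<theta>)) * x a - \<gamma> * x b) \<le> \<delta> * S"
    using pgst_eigenfunction_approx[OF assms(1,2) \<open>\<delta> > 0\<close>] assms(3) unfolding S_def by metis
  moreover have "\<bar>norm (cis (- (\<tau> * \<theta>)) * x a) - norm (\<gamma> * x b)\<bar>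
      \<le> norm (cis (- (\<tau> * \<theta>)) * x a - \<gamma> * x b)" by (rule norm_triangle_ineq3)
  ultimately have "\<bar>norm (x a) - norm (x b)\<bar> \<le> \<delta> * S" by (simp add: norm_mult)
  also have "\<dots> < \<delta> * (S + 1)" using \<open>\<delta> > 0\<close> by simp
  also have "\<dots> = \<bar>norm (x a) - norm (x b)\<bar>" using \<open>S \<ge> 0\<close> by (simp add: \<delta>_def)
  finally show False by simp
qed

section \<open>Eigenvectors of the corona\<close>

lemma graph_eigenfunction_corona_edgeless:
  fixes G :: "'n::finite graph" and x :: "'n \<times> 'm::finite option \<Rightarrow> complex"
  assumes centre: "\<And>v. (\<Sum>u | G v u. x (u, None)) + (\<Sum>i\<in>UNIV. x (v, Some i)) = of_real \<theta> * x (v, None)"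
    and leaf: "\<And>v i. x (v, None) = of_real \<theta> * x (v, Some i)"
  shows "graph_eigenfunction (corona G edgeless_graph) \<theta> x"
  unfolding graph_eigenfunction_def
proof
  fix p :: "'n \<times> 'm option"
  obtain v w where p: "p = (v, w)" by (cases p)
  show "(\<Sum>q | corona G edgeless_graph p q. x q) = of_real \<theta> * x p"
  proof (cases w)
    case None
    have nbrs: "{q. corona G edgeless_graph p q} = (\<lambda>u. (u, None)) ` {u. G v u} \<union> (\<lambda>i. (v, Some i)) ` UNIV"
      using option.exhaust by (auto simp: p None corona_def edgeless_graph_def image_iff)
    have "(\<Sum>q | corona G edgeless_graph p q. x q)
        = (\<Sum>u | G v u. x (u, None)) + (\<Sum>i\<in>UNIV. x (v, Some i))"
      unfolding nbrs
      by (subst sum.union_disjoint) (auto simp: sum.reindex inj_on_def)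
    then show ?thesis using centre by (simp add: p None)
  next
    case (Some i)
    have "{q. corona G edgeless_graph p q} = {(v, None)}"
      by (auto simp: p Some corona_def edgeless_graph_def)
    then show ?thesis using leaf by (simp add: p Some)
  qed
qed

lemma graph_eigenfunction_leaf_difference:
  fixes G :: "'n::finite graph" and i j :: "'m::finite"
  shows "graph_eigenfunction (corona G edgeless_graph) 0
    (\<lambda>q. of_bool (q = (v, Some i)) - of_bool (q = (v, Some j)))"
proof (rule graph_eigenfunction_corona_edgeless)
  fix u :: 'n
  have one: "(\<Sum>l\<in>UNIV. of_bool (u = v \<and> l = k) :: complex) = of_bool (u = v)" for k :: 'm
    by (cases "u = v") (auto simp: of_bool_def)
  show "(\<Sum>t | G u t. of_bool ((t, None) = (v, Some i)) - of_bool ((t, None) = (v, Some j)))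
      + (\<Sum>l\<in>UNIV. of_bool ((u, Some l) = (v, Some i)) - of_bool ((u, Some l) = (v, Some j)))
      = complex_of_real 0 * (of_bool ((u, None) = (v, Some i)) - of_bool ((u, None) = (v, Some j)))"
    by (simp add: sum_subtractf one)
qed simp

text \<open>A function \<open>c\<close> with sum zero has eigenvalue \<open>-1\<close> on the complete graph. With \<open>\<theta> c\<close> on the
  centres and \<open>c\<close> on the leaves, the leaf equations hold for every \<open>\<theta>\<close>, and the centre equations
  read \<open>- \<theta> c + 2 c = \<theta>\<^sup>2 c\<close>.\<close>

lemma graph_eigenfunction_corona_complete:
  fixes c :: "'n::finite \<Rightarrow> complex"
  assumes "CARD('m::finite) = 2" and "(\<Sum>u\<in>UNIV. c u) = 0" and "\<theta> = 1 \<or> \<theta> = - 2"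
  shows "graph_eigenfunction (corona complete_graph (edgeless_graph :: 'm graph)) \<theta>
    (\<lambda>(u, w). if w = None then of_real \<theta> * c u else c u)"
proof (rule graph_eigenfunction_corona_edgeless)
  fix v :: 'n
  have "{u. complete_graph v u} = UNIV - {v}" by (auto simp: complete_graph_def)
  then have "(\<Sum>u | complete_graph v u. c u) = - c v"
    using assms(2) by (simp add: sum_diff1)
  then show "(\<Sum>u | complete_graph v u. case (u, None :: 'm option) of
        (u, w) \<Rightarrow> if w = None then of_real \<theta> * c u else c u)
      + (\<Sum>i\<in>(UNIV::'m set). case (v, Some i) of (u, w) \<Rightarrow> if w = None then of_real \<theta> * c u else c u)
      = of_real \<theta> * (case (v, None :: 'm option) of (u, w) \<Rightarrow> if w = None then of_real \<theta> * c u else c u)"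
    using assms(1,3) by (auto simp: sum_distrib_left[symmetric] sum_negf)
qed simp

section \<open>Pairs of vertices in the corona of a complete graph\<close>

text \<open>The leaf difference at one endpoint has modulus \<open>1\<close> there and must not vanish at the other.\<close>

lemma pgst_corona_leaf:
  fixes G :: "'n::finite graph" and a b :: "'n \<times> 'm::finite option"
  assumes "simple_graph G" and "CARD('m) = 2" and "a \<noteq> b"
    and pgst: "pretty_good_state_transfer (corona G edgeless_graph) a b"
    and leaf: "snd a \<noteq> None \<or> snd b \<noteq> None"
  obtains v i j where "a = (v, Some i)" "b = (v, Some j)" "i \<noteq> j"
proof -
  have eq: "norm (of_bool (a = (v, Some i)) - of_bool (a = (v, Some j)) :: complex)
      = norm (of_bool (b = (v, Some i)) - of_bool (b = (v, Some j)) :: complex)" for v i j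
    by (rule pgst_eigenfunction_norm_eq[OF simple_graph_corona[OF assms(1) simple_graph_edgeless_graph]
          pgst graph_eigenfunction_leaf_difference])
  have other: "\<exists>j. j \<noteq> i" for i :: 'm
    using assms(2) by (metis UNIV_I card_2_iff')
  from leaf show ?thesis
  proof
    assume "snd a \<noteq> None"
    then obtain v i where a: "a = (v, Some i)" by (cases a) auto
    obtain j where "j \<noteq> i" using other by blast
    then have "b = (v, Some j)"
      using eq[of v i j] a \<open>a \<noteq> b\<close> by (auto simp: of_bool_def split: if_splits)
    with a \<open>j \<noteq> i\<close> show ?thesis using that by blast
  next
    assume "snd b \<noteq> None"
    then obtain v i where b: "b = (v, Some i)" by (cases b) auto
    obtain j where "j \<noteq> i" using other by blast
    then have "a = (v, Some j)"
      using eq[of v i j] b \<open>a \<noteq> b\<close> by (auto simp: of_bool_def split: if_splits)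
    with b \<open>j \<noteq> i\<close> show ?thesis using that by blast
  qed
qed

lemma no_pgst_between_centres:
  fixes v w :: "'n::finite"
  assumes "CARD('n) \<ge> 3" and "CARD('m::finite) = 2" and "v \<noteq> w"
  shows "\<not> pretty_good_state_transfer
    (corona complete_graph (edgeless_graph :: 'm graph)) (v, None) (w, None)"
proof
  assume pgst: "pretty_good_state_transfer
    (corona complete_graph (edgeless_graph :: 'm graph)) (v, None) (w, None)"
  have "card {v, w} < CARD('n)" using assms(1,3) by simp
  then have "{v, w} \<noteq> UNIV" by (metis less_irrefl)
  then obtain u where u: "u \<noteq> v" "u \<noteq> w" by auto
  define c :: "'n \<Rightarrow> complex" where "c = (\<lambda>t. of_bool (t = v) - of_bool (t = u))"
  have "(\<Sum>t\<in>UNIV. c t) = 0" by (simp add: c_def sum_subtractf of_bool_def)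
  from pgst_eigenfunction_norm_eq[OF simple_graph_corona[OF simple_graph_complete_graph
        simple_graph_edgeless_graph] pgst graph_eigenfunction_corona_complete[OF assms(2) this, of 1]]
  have "norm (c v) = norm (c w)" by simp
  then show False using u assms(3) by (simp add: c_def)
qed

text \<open>The first two bounds put \<open>z\<close> near \<open>-1\<close>, hence \<open>z\<^sup>2\<close> near \<open>1\<close>; then the last bound puts
  \<open>\<gamma>\<close> near \<open>1\<close>, against the first.\<close>

lemma phases_not_near:
  fixes z \<gamma> :: complex
  assumes "norm z = 1" "norm \<gamma> = 1"
    and "norm (1 + \<gamma>) \<le> 1/4" "norm (z - \<gamma>) \<le> 1/4" "norm (1 - \<gamma> * z\<^sup>2) \<le> 1/4"
  shows False
proof -
  have "norm (z + 1) \<le> norm (z - \<gamma>) + norm (1 + \<gamma>)"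
    using norm_triangle_ineq[of "z - \<gamma>" "1 + \<gamma>"] by (simp add: add.commute)
  then have z: "norm (z + 1) \<le> 1/2" using assms(3,4) by linarith
  have "norm (\<gamma> * (z\<^sup>2 - 1)) = norm (z - 1) * norm (z + 1)"
    using assms(2) square_diff_one_factored[of z] by (simp add: norm_mult power2_eq_square)
  also have "\<dots> \<le> 2 * (1/2)"
    using z norm_triangle_ineq4[of z 1] assms(1) by (intro mult_mono) auto
  finally have sq: "norm (\<gamma> * (z\<^sup>2 - 1)) \<le> 1" by simp
  have "2 = norm ((1 + \<gamma>) + (1 - \<gamma> * z\<^sup>2) + \<gamma> * (z\<^sup>2 - 1))" by (simp add: algebra_simps)
  also have "\<dots> \<le> norm (1 + \<gamma>) + norm (1 - \<gamma> * z\<^sup>2) + norm (\<gamma> * (z\<^sup>2 - 1))"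
    by (intro order_trans[OF norm_triangle_ineq] add_right_mono norm_triangle_ineq)
  finally show False using assms(3,5) sq by linarith
qed

lemma no_pgst_between_leaves:
  fixes v :: "'n::finite" and i j :: "'m::finite"
  assumes "CARD('n) \<ge> 2" and "CARD('m) = 2" and "i \<noteq> j"
  shows "\<not> pretty_good_state_transfer
    (corona complete_graph (edgeless_graph :: 'm graph)) (v, Some i) (v, Some j)"
proof
  let ?G = "corona complete_graph (edgeless_graph :: 'm graph) :: ('n \<times> 'm option) graph"
  assume pgst: "pretty_good_state_transfer ?G (v, Some i) (v, Some j)"
  have "card {v} < CARD('n)" using assms(1) by simp
  then have "{v} \<noteq> UNIV" by (metis less_irrefl)
  then obtain u where u: "u \<noteq> v" by auto
  define c :: "'n \<Rightarrow> complex" where "c = (\<lambda>t. of_bool (t = v) - of_bool (t = u))"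
  have c: "(\<Sum>t\<in>UNIV. c t) = 0" "c v = 1"
    using u by (auto simp: c_def sum_subtractf of_bool_def)
  define x0 :: "'n \<times> 'm option \<Rightarrow> complex"
    where "x0 = (\<lambda>q. of_bool (q = (v, Some i)) - of_bool (q = (v, Some j)))"
  define x where "x \<theta> = (\<lambda>(u, w :: 'm option). if w = None then of_real \<theta> * c u else c u)" for \<theta> :: real
  have ev: "graph_eigenfunction ?G 0 x0" "graph_eigenfunction ?G 1 (x 1)"
    "graph_eigenfunction ?G (- 2) (x (- 2))"
    unfolding x0_def x_def
    using graph_eigenfunction_leaf_difference graph_eigenfunction_corona_complete[OF assms(2) c(1)]
    by auto
  define N where "N y = (\<Sum>q\<in>UNIV. norm (y q))" for y :: "'n \<times> 'm option \<Rightarrow> complex"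
  have N: "N y \<ge> 0" for y by (simp add: N_def sum_nonneg)
  define S where "S = 1 + N x0 + N (x 1) + N (x (- 2))"
  have S: "S > 0" "N x0 \<le> S" "N (x 1) \<le> S" "N (x (- 2)) \<le> S"
    using N[of x0] N[of "x 1"] N[of "x (- 2)"] by (auto simp: S_def)
  have "1 / (4 * S) > 0" using S(1) by simp
  obtain \<tau> \<gamma> where \<gamma>: "norm \<gamma> = 1"
    and approx: "\<And>\<theta> y. graph_eigenfunction ?G \<theta> y \<Longrightarrow>
      norm (cis (- (\<tau> * \<theta>)) * y (v, Some i) - \<gamma> * y (v, Some j)) \<le> 1 / (4 * S) * N y"
    by (rule pgst_eigenfunction_approx[OF simple_graph_corona[OF simple_graph_complete_graph
          simple_graph_edgeless_graph] pgst \<open>1 / (4 * S) > 0\<close>, folded N_def]) (rule that)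
  have scale: "1 / (4 * S) * N y \<le> 1 / 4" if "N y \<le> S" for y
    using that S(1) by (simp add: field_simps)
  define z where "z = cis (- \<tau>)"
  have "norm (1 + \<gamma>) \<le> 1/4"
    using order_trans[OF approx[OF ev(1)] scale[OF S(2)]] assms(3) by (simp add: x0_def)
  moreover have "norm (z - \<gamma>) \<le> 1/4"
    using order_trans[OF approx[OF ev(2)] scale[OF S(3)]] by (simp add: x_def c(2) z_def)
  moreover have "norm (1 - \<gamma> * z\<^sup>2) \<le> 1/4"
  proof -
    \<comment> \<open>The phase of the eigenvalue \<open>-2\<close> is the inverse of \<open>z\<^sup>2\<close>.\<close>
    have "1 - \<gamma> * z\<^sup>2 = (cis (\<tau> * 2) - \<gamma>) * z\<^sup>2"
      by (simp add: z_def algebra_simps power2_eq_square cis_mult)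
    then have "norm (1 - \<gamma> * z\<^sup>2) = norm (cis (\<tau> * 2) - \<gamma>)"
      by (simp add: norm_mult norm_power z_def)
    then show ?thesis
      using order_trans[OF approx[OF ev(3)] scale[OF S(4)]] by (simp add: x_def c(2))
  qed
  ultimately show False using phases_not_near[of z \<gamma>] \<gamma> by (simp add: z_def)
qed

theorem theorem5p2:
  fixes n :: nat
    and a b :: "'n::finite \<times> 'm::finite option"
  assumes "n \<ge> 3"
    and "CARD('n) = n"
    and "CARD('m) = 2"
    and "a \<noteq> b"
  shows "\<not> pretty_good_state_transfer
           (corona (complete_graph :: 'n graph) (edgeless_graph :: 'm graph)) a b"
proof
  assume pgst: "pretty_good_state_transfer
    (corona (complete_graph :: 'n graph) (edgeless_graph :: 'm graph)) a b"
  show False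
  proof (cases "snd a \<noteq> None \<or> snd b \<noteq> None")
    case True
    from pgst_corona_leaf[OF simple_graph_complete_graph assms(3,4) pgst True]
    obtain v i j where "a = (v, Some i)" "b = (v, Some j)" "i \<noteq> j" .
    then show False
      using no_pgst_between_leaves[where 'n = 'n and 'm = 'm] pgst assms(1,2,3) by auto
  next
    case False
    then obtain v w where "a = (v, None)" "b = (w, None)"
      by (cases a; cases b) auto
    then show False
      using no_pgst_between_centres[where 'n = 'n and 'm = 'm] pgst assms by auto
  qed
qed

end
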